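(* Let $r\ge 1$ be an integer, let $\eta_0,u_0\in L^2(a,b)$, let $T>0$, and let $\tilde\eta:[0,T]\to\mathcal{P}^r_p$ and $\tilde u:[0,T]\to\mathcal{P}^r_p$ (continuously differentiable in $t$) be a solution of the semidiscrete system: for all $t\in[0,T]$, $$ \begin{aligned} (\tilde\eta_t,\chi)+\tfrac{1}{6}\big((P^r_p[\tilde\eta_x])_t,\chi_x\big)&=\big(P^r_p[(1+\tilde\eta)\tilde u],\chi_x\big) &&\text{for all }\chi\in\mathcal{P}^r_p,\\ (\tilde u_t,\psi)+\tfrac{1}{6}\big((P^r_p[\tilde u_x])_t,\psi_x\big)&=\tfrac{1}{2}\big(P^r_p[\tilde u^2],\psi_x\big)+\big(P^r_p[\tilde\eta],\psi_x\big) &&\text{for all }\psi\in\mathcal{P}^r_p, \end{aligned} $$ with initial conditions $\tilde\eta(\cdot,0)=P^r_p[\eta_0]$ and $\tilde u(\cdot,0)=P^r_p[u_0]$. Then for all $t\in[0,T]$: (i) (conservation of mass) $\displaystyle\frac{\mathrm{d}}{\mathrm{d}t}\mathcal{M}(t;\tilde\eta)=0$; (ii) (conservation of momentum) $\displaystyle\frac{\mathrm{d}}{\mathrm{d}t}\mathcal{I}(t;\tilde u)=0$; (iii) (conservation of energy) $\displaystyle\frac{\mathrm{d}}{\mathrm{d}t}\mathcal{E}(t;\tilde\eta,\tilde u)=0$.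
   Context: Let $a<b$ be real numbers and let $a=x_0<x_1<\cdots<x_N=b$ be a uniform partition of $[a,b]$. For an integer $r\ge1$, let $\mathbb{P}^r$ be the space of polynomials of degree at most $r$, and define the Lagrange finite element space and its periodic subspace $$\mathcal{P}^r:=\{\phi\in C([a,b]):\ \phi|_{[x_j,x_{j+1}]}\in\mathbb{P}^r,\ 0\le j\le N-1\},\qquad \mathcal{P}^r_p:=\{\phi\in\mathcal{P}^r:\ \phi(a)=\phi(b)\}.$$ Let $(u,v):=\int_a^b uv\,\mathrm{d}x$ denote the $L^2(a,b)$ inner product. $P^r_p:L^2(a,b)\to\mathcal{P}^r_p$ denotes the $L^2$-orthogonal projection, i.e. $(P^r_p[u],\phi)=(u,\phi)$ for all $\phi\in\mathcal{P}^r_p$. Subscripts $x$ and $t$ denote derivatives in $x$ (weak, i.e. piecewise on the partition, for finite element functions) and in $t$. The mass, momentum and energy functionals (nondimensional form) are $$\mathcal{M}(t;\eta):=\int_a^b\eta(x,t)\,\mathrm{d}x,\qquad \mathcal{I}(t;u):=\int_a^b u(x,t)\,\mathrm{d}x,\qquad \mathcal{E}(t;\eta,u):=\frac12\int_a^b\Big(\eta(x,t)^2+(1+\eta(x,t))\,u(x,t)^2\Big)\mathrm{d}x.$$ The system is a semidiscretisation of the regularised shallow water (BBM-BBM) system $\eta_t+[(1+\eta)u]_x-\frac16\eta_{xxt}=0$, $u_t+\eta_x+uu_x-\frac16u_{xxt}=0$ on $[a,b]$ with periodic boundary conditions and initial data $\eta_0,u_0$. *)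

theory Defs
  imports "HOL-Analysis.Analysis" "HOL-Computational_Algebra.Polynomial"
begin

definition node :: "real \<Rightarrow> real \<Rightarrow> nat \<Rightarrow> nat \<Rightarrow> real" where
  "node a b N j = a + real j * (b - a) / real N"

text \<open>A function on \<open>[a, b]\<close> is represented by its extension by zero to the whole line, so that
  equality of elements of the finite element spaces is equality on \<open>[a, b]\<close>.\<close>

definition lagrange_space :: "real \<Rightarrow> real \<Rightarrow> nat \<Rightarrow> nat \<Rightarrow> (real \<Rightarrow> real) set" where
  "lagrange_space a b N r =
     {\<phi>. continuous_on {a..b} \<phi> \<and>
         (\<forall>j<N. \<exists>p :: real poly. degree p \<le> r \<and>
            (\<forall>x\<in>{node a b N j..node a b N (Suc j)}. \<phi> x = poly p x)) \<and>
         (\<forall>x. x \<notin> {a..b} \<longrightarrow> \<phi> x = 0)}"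

definition periodic_lagrange_space :: "real \<Rightarrow> real \<Rightarrow> nat \<Rightarrow> nat \<Rightarrow> (real \<Rightarrow> real) set" where
  "periodic_lagrange_space a b N r = {\<phi> \<in> lagrange_space a b N r. \<phi> a = \<phi> b}"

definition square_integrable_on :: "real \<Rightarrow> real \<Rightarrow> (real \<Rightarrow> real) \<Rightarrow> bool" where
  "square_integrable_on a b f \<longleftrightarrow>
     f \<in> borel_measurable (lebesgue_on {a..b}) \<and> integrable (lebesgue_on {a..b}) (\<lambda>x. (f x)\<^sup>2)"

definition L2_inner :: "real \<Rightarrow> real \<Rightarrow> (real \<Rightarrow> real) \<Rightarrow> (real \<Rightarrow> real) \<Rightarrow> real" where
  "L2_inner a b f g = (LINT x|lebesgue_on {a..b}. f x * g x)"

definition L2_proj :: "real \<Rightarrow> real \<Rightarrow> nat \<Rightarrow> nat \<Rightarrow> (real \<Rightarrow> real) \<Rightarrow> (real \<Rightarrow> real)" where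
  "L2_proj a b N r f =
     (THE p. p \<in> periodic_lagrange_space a b N r \<and>
        (\<forall>\<phi>\<in>periodic_lagrange_space a b N r. L2_inner a b p \<phi> = L2_inner a b f \<phi>))"

text \<open>The weak derivative of a finite element function: the classical derivative on each open cell.
  The value 0 at the nodes is immaterial, the nodes being a null set.\<close>

definition deriv_x :: "real \<Rightarrow> real \<Rightarrow> nat \<Rightarrow> (real \<Rightarrow> real) \<Rightarrow> (real \<Rightarrow> real)" where
  "deriv_x a b N \<phi> =
     (\<lambda>x. if \<exists>j<N. node a b N j < x \<and> x < node a b N (Suc j) then deriv \<phi> x else 0)"

text \<open>Functions of \<open>(x, t)\<close> are curves \<open>t \<mapsto> w t\<close> of functions of \<open>x\<close>. Time derivatives are taken
  within \<open>[0, T]\<close>, hence are one-sided at the end points.\<close>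

definition deriv_t :: "real \<Rightarrow> (real \<Rightarrow> real \<Rightarrow> real) \<Rightarrow> real \<Rightarrow> (real \<Rightarrow> real)" where
  "deriv_t T w t = (\<lambda>x. vector_derivative (\<lambda>s. w s x) (at t within {0..T}))"

text \<open>Continuous differentiability of a curve \<open>[0, T] \<rightarrow> V\<close>, for \<open>V\<close> a subspace of \<open>C([a, b])\<close> with
  the supremum norm: the difference quotients converge in norm to the derivative, which is itself
  continuous in norm. On the finite-dimensional spaces above all norms are equivalent, so the choice
  of norm does not matter.\<close>

definition C1_curve :: "real \<Rightarrow> real \<Rightarrow> real \<Rightarrow> (real \<Rightarrow> real) set \<Rightarrow> (real \<Rightarrow> real \<Rightarrow> real) \<Rightarrow> bool" where
  "C1_curve a b T V w \<longleftrightarrow>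
     (\<forall>t\<in>{0..T}. w t \<in> V) \<and>
     (\<forall>t\<in>{0..T}. uniform_limit {a..b} (\<lambda>s x. (w s x - w t x) / (s - t)) (deriv_t T w t)
                    (at t within {0..T})) \<and>
     (\<forall>t\<in>{0..T}. uniform_limit {a..b} (deriv_t T w) (deriv_t T w t) (at t within {0..T}))"

definition mass :: "real \<Rightarrow> real \<Rightarrow> real \<Rightarrow> (real \<Rightarrow> real \<Rightarrow> real) \<Rightarrow> real" where
  "mass a b t \<eta> = (LINT x|lebesgue_on {a..b}. \<eta> t x)"

definition momentum :: "real \<Rightarrow> real \<Rightarrow> real \<Rightarrow> (real \<Rightarrow> real \<Rightarrow> real) \<Rightarrow> real" where
  "momentum a b t u = (LINT x|lebesgue_on {a..b}. u t x)"

definition energy ::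
  "real \<Rightarrow> real \<Rightarrow> real \<Rightarrow> (real \<Rightarrow> real \<Rightarrow> real) \<Rightarrow> (real \<Rightarrow> real \<Rightarrow> real) \<Rightarrow> real" where
  "energy a b t \<eta> u =
     1 / 2 * (LINT x|lebesgue_on {a..b}. (\<eta> t x)\<^sup>2 + (1 + \<eta> t x) * (u t x)\<^sup>2)"

end

theory Submission
  imports Defs
begin

text \<open>Let \<open>V\<close> be the periodic finite element space, \<open>D\<close> the weak derivative and \<open>P\<close> the projection.
  Integration by parts and periodicity make \<open>D\<close> skew on \<open>V\<close>, and \<open>A = P D\<close> commutes with the time
  derivative. With \<open>F = P[(1 + \<eta>) u]\<close> and \<open>G = P[\<eta> + u\<^sup>2 / 2]\<close>, put \<open>K = F - A \<eta>\<^sub>t / 6\<close> and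
  \<open>H = G - A u\<^sub>t / 6\<close>; the scheme then reads \<open>(\<eta>\<^sub>t, \<chi>) = (K, D \<chi>)\<close> and \<open>(u\<^sub>t, \<psi>) = (H, D \<psi>)\<close>.
  Testing with \<open>1\<close> gives mass and momentum. The energy has time derivative
  \<open>(G, \<eta>\<^sub>t) + (F, u\<^sub>t) = (K, D H) + (H, D K) + ((D u\<^sub>t, \<eta>\<^sub>t) + (D \<eta>\<^sub>t, u\<^sub>t)) / 6\<close>,
  and both pairs cancel by skewness. All statements about \<open>V\<close> use a finite set \<open>E \<subseteq> V\<close> with
  \<open>f = (\<Sum>e\<in>E. (f, e) e)\<close> for \<open>f \<in> V\<close>, in terms of which \<open>P\<close> is explicit.\<close>

section \<open>Bounded measurable functions and the inner product\<close>

text \<open>This class holds every integrand that occurs: it contains the continuous functions and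
  the weak derivatives, which may jump at nodes, is closed under sums and products, and consists of
  integrable functions because \<open>{a..b}\<close> has finite measure.\<close>

definition bounded_measurable_on :: "real \<Rightarrow> real \<Rightarrow> (real \<Rightarrow> real) \<Rightarrow> bool" where
  "bounded_measurable_on a b f \<longleftrightarrow>
     f \<in> borel_measurable (lebesgue_on {a..b}) \<and> bounded (f ` {a..b})"

lemma bounded_measurable_on_continuous:
  "continuous_on {a..b} f \<Longrightarrow> bounded_measurable_on a b f"
  unfolding bounded_measurable_on_def
  by (meson compact_Icc compact_continuous_image compact_imp_bounded
      continuous_imp_measurable_on_sets_lebesgue fmeasurableD lmeasurable_interval(1) 
      lebesgue_closedin sets_lborel atLeastAtMost_borel sets_completionI_sets)

lemma bounded_measurable_on_const: "bounded_measurable_on a b (\<lambda>x. c)"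
  by (simp add: bounded_measurable_on_continuous)

lemma bounded_measurable_on_add:
  assumes "bounded_measurable_on a b f" "bounded_measurable_on a b g"
  shows "bounded_measurable_on a b (\<lambda>x. f x + g x)"
  using assms bounded_plus_comp[of f "{a..b}" g] by (auto simp: bounded_measurable_on_def)

lemma bounded_mult_comp:
  fixes f g :: "'a \<Rightarrow> real"
  assumes "bounded (f ` X)" "bounded (g ` X)"
  shows "bounded ((\<lambda>x. f x * g x) ` X)"
proof -
  obtain A B where A: "\<And>x. x \<in> X \<Longrightarrow> \<bar>f x\<bar> \<le> A" and B: "\<And>x. x \<in> X \<Longrightarrow> \<bar>g x\<bar> \<le> B"
    using assms unfolding bounded_iff by (metis image_eqI real_norm_def)
  have "\<bar>f x * g x\<bar> \<le> A * B" if "x \<in> X" for x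
    unfolding abs_mult using A[OF that] B[OF that] by (intro mult_mono) auto
  then show ?thesis
    unfolding bounded_iff by (intro exI[of _ "A * B"]) auto
qed

lemma bounded_measurable_on_mult:
  assumes "bounded_measurable_on a b f" "bounded_measurable_on a b g"
  shows "bounded_measurable_on a b (\<lambda>x. f x * g x)"
  using assms bounded_mult_comp[of f "{a..b}" g] by (auto simp: bounded_measurable_on_def)

lemma bounded_measurable_on_cmult:
  "bounded_measurable_on a b f \<Longrightarrow> bounded_measurable_on a b (\<lambda>x. c * f x)"
  by (intro bounded_measurable_on_mult bounded_measurable_on_const)

lemma bounded_measurable_on_sum:
  assumes "\<And>i. i \<in> I \<Longrightarrow> bounded_measurable_on a b (f i)"
  shows "bounded_measurable_on a b (\<lambda>x. \<Sum>i\<in>I. f i x)"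
  using assms
  by (induction I rule: infinite_finite_induct)
    (auto intro: bounded_measurable_on_add bounded_measurable_on_const)

lemma bounded_measurable_on_integrable:
  assumes "bounded_measurable_on a b f"
  shows "integrable (lebesgue_on {a..b}) f"
proof -
  obtain B where "\<And>x. x \<in> {a..b} \<Longrightarrow> \<bar>f x\<bar> \<le> B"
    using assms unfolding bounded_measurable_on_def bounded_iff by (metis image_eqI real_norm_def)
  then show ?thesis
    using assms unfolding bounded_measurable_on_def
    by (intro finite_measure.integrable_const_bound[where B=B] finite_measure_lebesgue_on) auto
qed

lemma L2_inner_commute: "L2_inner a b f g = L2_inner a b g f"
  by (simp add: L2_inner_def mult.commute)

lemma L2_inner_add_left:
  assumes "bounded_measurable_on a b f" "bounded_measurable_on a b g" "bounded_measurable_on a b h"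
  shows "L2_inner a b (\<lambda>x. f x + g x) h = L2_inner a b f h + L2_inner a b g h"
  using assms unfolding L2_inner_def distrib_right
  by (intro Bochner_Integration.integral_add bounded_measurable_on_integrable
      bounded_measurable_on_mult)

lemma L2_inner_cmult_left: "L2_inner a b (\<lambda>x. c * f x) h = c * L2_inner a b f h"
  by (simp add: L2_inner_def mult.assoc)

lemma L2_inner_linear_left:
  assumes "bounded_measurable_on a b f" "bounded_measurable_on a b g" "bounded_measurable_on a b h"
  shows "L2_inner a b (\<lambda>x. c * f x + d * g x) h = c * L2_inner a b f h + d * L2_inner a b g h"
  using assms by (simp only: L2_inner_add_left bounded_measurable_on_cmult L2_inner_cmult_left)

lemma L2_inner_sum_left:
  assumes "\<And>i. i \<in> I \<Longrightarrow> bounded_measurable_on a b (f i)" "bounded_measurable_on a b h"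
  shows "L2_inner a b (\<lambda>x. \<Sum>i\<in>I. f i x) h = (\<Sum>i\<in>I. L2_inner a b (f i) h)"
  using assms
proof (induction I rule: infinite_finite_induct)
  case (insert i I)
  then show ?case
    by (simp add: L2_inner_add_left bounded_measurable_on_sum)
qed (auto simp: L2_inner_def)

text \<open>A continuous nonnegative integrand with zero integral over a nondegenerate interval
  vanishes at every point, not just almost everywhere. The extension by zero makes this an equality
  of functions on the line.\<close>

lemma L2_inner_eq_0_imp_zero:
  assumes "a < b" "continuous_on {a..b} f" "\<And>x. x \<notin> {a..b} \<Longrightarrow> f x = 0" "L2_inner a b f f = 0"
  shows "f = (\<lambda>x. 0)"
proof -
  have bm: "bounded_measurable_on a b (\<lambda>x. f x * f x)"
    using assms by (intro bounded_measurable_on_continuous continuous_intros)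
  have "((\<lambda>x. f x * f x) has_integral 0) (cbox a b)"
    using has_integral_integral_lebesgue_on[OF bounded_measurable_on_integrable[OF bm]] assms(4)
    by (simp add: L2_inner_def)
  then have "f x * f x = 0" if "x \<in> {a..b}" for x
    using has_integral_0_cbox_imp_0[of a b "\<lambda>x. f x * f x" x] assms(1,2) that
    by (auto intro!: continuous_intros simp: box_real)
  then show ?thesis
    using assms(3) by fastforce
qed

text \<open>The difference of the inner products is at most the supremum distance times a bound of
  \<open>g\<close> times the length of the interval. This is what later carries time derivatives
  under the integral.\<close>

lemma L2_inner_tendsto:
  assumes lim: "uniform_limit {a..b} f l F"
    and f: "\<forall>\<^sub>F s in F. bounded_measurable_on a b (f s)"
    and l: "bounded_measurable_on a b l" and g: "bounded_measurable_on a b g"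
  shows "((\<lambda>s. L2_inner a b (f s) g) \<longlongrightarrow> L2_inner a b l g) F"
proof (cases "a \<le> b")
  case True
  obtain B where B: "\<And>x. x \<in> {a..b} \<Longrightarrow> \<bar>g x\<bar> \<le> B" "B > 0"
    using g unfolding bounded_measurable_on_def bounded_pos by (metis image_eqI real_norm_def)
  show ?thesis
  proof (rule tendstoI)
    fix e :: real assume "e > 0"
    \<comment> \<open>The summand 1 keeps the denominator positive for \<open>a = b\<close> and
      makes the final bound strict, since \<open>(b - a) / (b - a + 1) < 1\<close>.\<close>
    define d where "d = e / (B * (b - a + 1))"
    have "d > 0" using \<open>e > 0\<close> B True by (simp add: d_def)
    have "\<forall>\<^sub>F s in F. \<forall>x\<in>{a..b}. dist (f s x) (l x) < d"
      using uniform_limitD[OF lim \<open>d > 0\<close>] .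
    with f show "\<forall>\<^sub>F s in F. dist (L2_inner a b (f s) g) (L2_inner a b l g) < e"
    proof eventually_elim
      case (elim s)
      have bm: "bounded_measurable_on a b (\<lambda>x. (f s x + -1 * l x) * g x)"
        by (intro bounded_measurable_on_mult bounded_measurable_on_add
            bounded_measurable_on_const elim l g)
      have "L2_inner a b (f s) g - L2_inner a b l g = L2_inner a b (\<lambda>x. f s x + -1 * l x) g"
        using L2_inner_linear_left[OF elim(1) l g, of 1 "-1"] by simp
      also have "\<bar>\<dots>\<bar> \<le> (LINT x|lebesgue_on {a..b}. \<bar>(f s x + -1 * l x) * g x\<bar>)"
        unfolding L2_inner_def by (rule integral_abs_bound)
      also have "\<dots> \<le> (LINT x|lebesgue_on {a..b}. d * B)"
      proof (rule integral_mono)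
        fix x assume "x \<in> space (lebesgue_on {a..b})"
        then have x: "x \<in> {a..b}" by simp
        then have "\<bar>f s x + -1 * l x\<bar> \<le> d"
          using elim by (force simp: dist_real_def)
        then show "\<bar>(f s x + -1 * l x) * g x\<bar> \<le> d * B"
          unfolding abs_mult using B(1)[OF x] \<open>d > 0\<close> by (intro mult_mono) auto
      qed (use bounded_measurable_on_integrable[OF bm] in auto)
      also have "\<dots> = d * B * (b - a)"
        using True by (simp add: measure_restrict_space)
      also have "\<dots> = e / (b - a + 1) * (b - a)"
        using B(2) by (simp add: d_def)
      also have "\<dots> < e"
        using \<open>e > 0\<close> True by (simp add: divide_simps)
      finally show ?case by (simp add: dist_real_def)
    qed
  qed
next
  case False
  \<comment> \<open>For \<open>a > b\<close> the underlying space is empty.\<close>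
  then have "L2_inner a b h g = 0" for h
    by (simp add: L2_inner_def integral_eq_zero_AE space_restrict_space
        AE_I2)
  then show ?thesis by simp
qed

section \<open>Subspaces of functions and Parseval frames\<close>

definition function_subspace :: "('a \<Rightarrow> real) set \<Rightarrow> bool" where
  "function_subspace V \<longleftrightarrow>
     (\<lambda>x. 0) \<in> V \<and> (\<forall>f\<in>V. \<forall>g\<in>V. \<forall>c d. (\<lambda>x. c * f x + d * g x) \<in> V)"

lemma function_subspaceD:
  "function_subspace V \<Longrightarrow> f \<in> V \<Longrightarrow> g \<in> V \<Longrightarrow> (\<lambda>x. c * f x + d * g x) \<in> V"
  by (simp add: function_subspace_def)

lemma function_subspace_sum:
  assumes "function_subspace V" "\<And>i. i \<in> I \<Longrightarrow> f i \<in> V"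
  shows "(\<lambda>x. \<Sum>i\<in>I. c i * f i x) \<in> V"
  using assms(2)
proof (induction I rule: infinite_finite_induct)
  case (insert i I)
  then show ?case
    using function_subspaceD[OF assms(1), of "f i" "\<lambda>x. \<Sum>i\<in>I. c i * f i x" "c i" 1] by simp
qed (use assms(1) in \<open>auto simp: function_subspace_def\<close>)

text \<open>Induction on the number of evaluation points: the functions vanishing at one more point form
  a subspace of codimension at most one, whose frame is completed by a unit vector orthogonal to
  that subspace.\<close>

lemma exists_parseval_frame:
  assumes "a < b" "finite X" "function_subspace V"
    and "\<And>f. f \<in> V \<Longrightarrow> continuous_on {a..b} f"
    and "\<And>f x. f \<in> V \<Longrightarrow> x \<notin> {a..b} \<Longrightarrow> f x = 0"
    and "\<And>f. f \<in> V \<Longrightarrow> (\<And>x. x \<in> X \<Longrightarrow> f x = 0) \<Longrightarrow> f = (\<lambda>x. 0)"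
  shows "\<exists>E. finite E \<and> E \<subseteq> V \<and> (\<forall>f\<in>V. f = (\<lambda>x. \<Sum>e\<in>E. L2_inner a b f e * e x))"
  using assms(2-6)
proof (induction X arbitrary: V rule: finite_induct)
  case empty
  then show ?case by (intro exI[of _ "{}"]) auto
next
  case (insert y X V)
  note V = insert.prems(1) and cont = insert.prems(2) and outside = insert.prems(3)
  note bm = bounded_measurable_on_continuous[OF cont]
  define V' where "V' = {f \<in> V. f y = 0}"
  have V': "function_subspace V'"
    using V by (auto simp: V'_def function_subspace_def)
  have "\<exists>E. finite E \<and> E \<subseteq> V' \<and> (\<forall>f\<in>V'. f = (\<lambda>x. \<Sum>e\<in>E. L2_inner a b f e * e x))"
  proof (rule insert.IH[OF V'])
    show "f = (\<lambda>x. 0)" if "f \<in> V'" "\<And>x. x \<in> X \<Longrightarrow> f x = 0" for f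
      using insert.prems(4)[of f] that by (auto simp: V'_def)
  qed (use cont outside in \<open>auto simp: V'_def\<close>)
  then obtain E where E: "finite E" "E \<subseteq> V'"
    and rep: "\<And>f. f \<in> V' \<Longrightarrow> f = (\<lambda>x. \<Sum>e\<in>E. L2_inner a b f e * e x)"
    by blast
  show ?case
  proof (cases "V' = V")
    case True
    with E rep show ?thesis by blast
  next
    case False
    then obtain w where w: "w \<in> V" "w y \<noteq> 0" by (auto simp: V'_def)
    \<comment> \<open>The candidate for the orthogonal projection of \<open>w\<close> onto
      \<open>V'\<close>. Subtracting it leaves the value at \<open>y\<close> unchanged, so the
      residual \<open>w1\<close> is nonzero.\<close>
    define p where "p = (\<lambda>x. \<Sum>e\<in>E. L2_inner a b w e * e x)"
    have p: "p \<in> V'" unfolding p_def using E by (intro function_subspace_sum V') auto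
    define w1 where "w1 = (\<lambda>x. 1 * w x + (-1) * p x)"
    have w1: "w1 \<in> V" "w1 y \<noteq> 0"
      using w p function_subspaceD[OF V, of w p 1 "-1"] by (auto simp: w1_def V'_def)
    have EV: "e \<in> V" if "e \<in> E" for e using that E by (auto simp: V'_def)
    have inner_sum: "L2_inner a b (\<lambda>x. \<Sum>e\<in>E. c e * e x) f = (\<Sum>e\<in>E. c e * L2_inner a b e f)"
      if "f \<in> V" for c f
      by (subst L2_inner_sum_left) (auto simp: L2_inner_cmult_left intro!: bm that EV
          bounded_measurable_on_cmult)
    have inner_lin: "L2_inner a b (\<lambda>x. c * f x + d * g x) h = 
        c * L2_inner a b f h + d * L2_inner a b g h" if "f \<in> V" "g \<in> V" "h \<in> V" for c d f g h
      by (intro L2_inner_linear_left bm that)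
    \<comment> \<open>Expanding \<open>f\<close> in its frame turns \<open>(f, w)\<close> into the
      very sum that expresses \<open>(p, f)\<close>. Only the frame identity is used; the elements
      of \<open>E\<close> are not assumed orthonormal.\<close>
    have orth: "L2_inner a b w1 f = 0" if "f \<in> V'" for f
    proof -
      have f: "f \<in> V" using that by (simp add: V'_def)
      have "L2_inner a b f w = (\<Sum>e\<in>E. L2_inner a b f e * L2_inner a b e w)"
        using inner_sum[OF w(1), of "L2_inner a b f"] rep[OF that] by simp
      moreover have "L2_inner a b p f = (\<Sum>e\<in>E. L2_inner a b w e * L2_inner a b e f)"
        unfolding p_def by (rule inner_sum[OF f])
      moreover have "\<dots> = (\<Sum>e\<in>E. L2_inner a b f e * L2_inner a b e w)"
        by (intro sum.cong refl) (metis L2_inner_commute mult.commute)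
      ultimately show ?thesis
        using p w f inner_lin[of w p f 1 "-1"] L2_inner_commute[of a b f w]
        unfolding w1_def by (auto simp: V'_def)
    qed
    have "L2_inner a b w1 w1 \<noteq> 0"
      using L2_inner_eq_0_imp_zero[OF assms(1) cont[OF w1(1)] outside[OF w1(1)]] w1(2) by auto
    moreover have "L2_inner a b w1 w1 \<ge> 0"
      unfolding L2_inner_def by (rule Bochner_Integration.integral_nonneg) simp
    ultimately have pos: "L2_inner a b w1 w1 > 0" by simp
    define k where "k = 1 / sqrt (L2_inner a b w1 w1)"
    define v where "v = (\<lambda>x. k * w1 x)"
    have v: "v \<in> V" "v y \<noteq> 0"
      using function_subspaceD[OF V w1(1) w1(1), of k 0] w1(2) pos by (auto simp: v_def k_def)
    have vv: "L2_inner a b v v = 1"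
      using pos L2_inner_commute[of a b w1 v] unfolding v_def L2_inner_cmult_left
      by (simp add: L2_inner_cmult_left k_def)
    have orth: "L2_inner a b v f = 0" if "f \<in> V'" for f
      unfolding v_def L2_inner_cmult_left using orth[OF that] by simp
    have "v \<notin> E" using v E by (auto simp: V'_def)
    have "f = (\<lambda>x. \<Sum>e\<in>insert v E. L2_inner a b f e * e x)" if f: "f \<in> V" for f
    proof -
      \<comment> \<open>This multiple of \<open>v\<close> removes the value at \<open>y\<close>, so
        that the remainder \<open>g\<close> lies in \<open>V'\<close>. As \<open>v\<close> is a unit
        vector orthogonal to \<open>V'\<close>, the same number is the coefficient
        \<open>(f, v)\<close>.\<close>
      define c where "c = f y / v y"
      define g where "g = (\<lambda>x. 1 * f x + (-c) * v x)"
      have g: "g \<in> V'"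
        using function_subspaceD[OF V f v(1), of 1 "-c"] v(2) by (auto simp: V'_def g_def c_def)
      have gh: "L2_inner a b g h = L2_inner a b f h - c * L2_inner a b v h" if "h \<in> V" for h
        unfolding g_def using inner_lin[OF f v(1) that, of 1 "-c"] by simp
      have "L2_inner a b f v = c"
        using gh[OF v(1)] vv orth[OF g] L2_inner_commute[of a b g v] by simp
      moreover have "L2_inner a b g e = L2_inner a b f e" if "e \<in> E" for e
        using gh[OF EV[OF that]] orth that E by auto
      then have "g x = (\<Sum>e\<in>E. L2_inner a b f e * e x)" for x
        using fun_cong[OF rep[OF g], of x] by simp
      ultimately show ?thesis
        using \<open>v \<notin> E\<close> E by (auto simp: g_def fun_eq_iff algebra_simps)
    qed
    then show ?thesis
      using E v EV by (intro exI[of _ "insert v E"]) auto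
  qed
qed

section \<open>Differentiation in time, uniformly in space\<close>

definition has_uniform_derivative_on ::
  "(real \<Rightarrow> 'a \<Rightarrow> real) \<Rightarrow> ('a \<Rightarrow> real) \<Rightarrow> 'a set \<Rightarrow> real \<Rightarrow> real set \<Rightarrow> bool" where
  "has_uniform_derivative_on w w' X t S \<longleftrightarrow>
     uniform_limit X (\<lambda>s x. (w s x - w t x) / (s - t)) w' (at t within S)"

lemma has_uniform_derivative_on_const:
  "has_uniform_derivative_on (\<lambda>s. c) (\<lambda>x. 0) X t S"
  by (simp add: has_uniform_derivative_on_def uniform_limit_iff)

lemma has_uniform_derivative_on_add:
  assumes "has_uniform_derivative_on f f' X t S" "has_uniform_derivative_on g g' X t S"
  shows "has_uniform_derivative_on (\<lambda>s x. f s x + g s x) (\<lambda>x. f' x + g' x) X t S"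
  using uniform_limit_add[OF assms[unfolded has_uniform_derivative_on_def]]
  by (simp add: has_uniform_derivative_on_def add_diff_add add_divide_distrib)

lemma has_uniform_derivative_on_mult:
  assumes f: "has_uniform_derivative_on f f' X t S" and g: "has_uniform_derivative_on g g' X t S"
    and bounded: "bounded (f t ` X)" "bounded (f' ` X)" "bounded (g t ` X)" "bounded (g' ` X)"
  shows "has_uniform_derivative_on (\<lambda>s x. f s x * g s x) (\<lambda>x. f' x * g t x + f t x * g' x) X t S"
proof -
  \<comment> \<open>The difference quotient of a product is \<open>p * g t + f t * q + (s - t) * p * q\<close>, where \<open>p\<close> and
    \<open>q\<close> are those of the factors. This also holds for \<open>s = t\<close>, as \<open>x / 0 = 0\<close>.\<close>
  let ?F = "at t within S"
  let ?qf = "\<lambda>s x. (f s x - f t x) / (s - t)" and ?qg = "\<lambda>s x. (g s x - g t x) / (s - t)"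
  note f = f[unfolded has_uniform_derivative_on_def] and g = g[unfolded has_uniform_derivative_on_def]
  have "((\<lambda>s. s - t) \<longlongrightarrow> 0) ?F"
    by (auto intro!: tendsto_eq_intros)
  \<comment> \<open>The factor \<open>s - t\<close> does not depend on \<open>x\<close>, so its
    convergence is automatically uniform.\<close>
  then have "uniform_limit X (\<lambda>s x. s - t) (\<lambda>x. 0) ?F"
    unfolding uniform_limit_iff tendsto_iff by (auto elim: eventually_mono)
  then have "uniform_limit X (\<lambda>s x. (s - t) * (?qf s x * ?qg s x)) (\<lambda>x. 0 * (f' x * g' x)) ?F"
    by (intro uniform_lim_mult f g bounded bounded_mult_comp) (auto simp: image_constant_conv)
  moreover have "uniform_limit X (\<lambda>s x. ?qf s x * g t x) (\<lambda>x. f' x * g t x) ?F"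
    by (intro uniform_lim_mult f bounded) (auto intro: uniform_limit_const)
  moreover have "uniform_limit X (\<lambda>s x. f t x * ?qg s x) (\<lambda>x. f t x * g' x) ?F"
    by (intro uniform_lim_mult g bounded) (auto intro: uniform_limit_const)
  ultimately have "uniform_limit X
      (\<lambda>s x. (?qf s x * g t x + f t x * ?qg s x) + (s - t) * (?qf s x * ?qg s x))
      (\<lambda>x. (f' x * g t x + f t x * g' x) + 0 * (f' x * g' x)) ?F"
    by (intro uniform_limit_add)
  moreover have "(?qf s x * g t x + f t x * ?qg s x) + (s - t) * (?qf s x * ?qg s x)
      = (f s x * g s x - f t x * g t x) / (s - t)" for s x
  proof (cases "s = t")
    case False
    have "((F - c) / d * e + c * ((G - e) / d)) + d * ((F - c) / d * ((G - e) / d)) = (F * G - c * e) / d"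
      if "d \<noteq> 0" for F G c d e :: real
      using that by (simp add: field_simps)
    with False show ?thesis by simp
  qed simp
  ultimately show ?thesis
    unfolding has_uniform_derivative_on_def by simp
qed

text \<open>By linearity the difference quotient of the inner product is the inner product of the
  difference quotient, to which \<open>L2_inner_tendsto\<close> applies. The quotient
  \<open>?q\<close> is written as a linear combination to fit
  \<open>L2_inner_linear_left\<close>.\<close>

lemma has_real_derivative_L2_inner:
  assumes w: "has_uniform_derivative_on w w' {a..b} t S" and t: "t \<in> S"
    and bm: "\<And>s. s \<in> S \<Longrightarrow> bounded_measurable_on a b (w s)"
      "bounded_measurable_on a b w'" "bounded_measurable_on a b g"
  shows "((\<lambda>s. L2_inner a b (w s) g) has_real_derivative L2_inner a b w' g) (at t within S)"
proof -
  let ?q = "\<lambda>s x. 1 / (s - t) * w s x + (- 1 / (s - t)) * w t x"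
  have "uniform_limit {a..b} ?q w' (at t within S)"
    using w by (simp add: has_uniform_derivative_on_def diff_divide_distrib)
  moreover have S: "\<forall>\<^sub>F s in at t within S. s \<in> S"
    by (simp add: eventually_at_filter)
  then have "\<forall>\<^sub>F s in at t within S. bounded_measurable_on a b (?q s)"
    by eventually_elim (intro bounded_measurable_on_add bounded_measurable_on_cmult bm t)
  ultimately have "((\<lambda>s. L2_inner a b (?q s) g) \<longlongrightarrow> L2_inner a b w' g) (at t within S)"
    by (rule L2_inner_tendsto[OF _ _ bm(2,3)])
  moreover have "\<forall>\<^sub>F s in at t within S. L2_inner a b (?q s) g =
      (L2_inner a b (w s) g - L2_inner a b (w t) g) / (s - t)"
    using S by eventually_elim
      (subst L2_inner_linear_left, auto intro!: bm t simp: diff_divide_distrib)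
  ultimately show ?thesis
    unfolding has_field_derivative_iff by (rule Lim_transform_eventually)
qed

section \<open>Nodes, cells and point evaluations on the finite element space\<close>

lemma node_mono: "a < b \<Longrightarrow> i \<le> j \<Longrightarrow> node a b N i \<le> node a b N j"
  by (auto simp: node_def intro!: divide_right_mono mult_right_mono)

lemma node_strict_mono: "a < b \<Longrightarrow> N \<ge> 1 \<Longrightarrow> i < j \<Longrightarrow> node a b N i < node a b N j"
  by (auto simp: node_def intro!: divide_strict_right_mono mult_strict_right_mono)

lemma node_0 [simp]: "node a b N 0 = a"
  by (simp add: node_def)

lemma node_N: "N \<ge> 1 \<Longrightarrow> node a b N N = b"
  by (simp add: node_def)

lemma node_in_interval: "a < b \<Longrightarrow> N \<ge> 1 \<Longrightarrow> j \<le> N \<Longrightarrow> node a b N j \<in> {a..b}"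
  using node_mono[of a b 0 j N] node_mono[of a b j N N] by (simp add: node_N)

lemma node_cell:
  assumes "N \<ge> 1" "x \<in> {a..b}"
  obtains j where "j < N" "x \<in> {node a b N j..node a b N (Suc j)}"
proof -
  \<comment> \<open>The first cell whose right end is not below \<open>x\<close>. By minimality the
    right end of the previous cell, which is the left end of this one, lies below
    \<open>x\<close>.\<close>
  define j where "j = (LEAST j. x \<le> node a b N (Suc j))"
  have ex: "x \<le> node a b N (Suc (N - 1))"
    using assms node_N[OF assms(1), of a b] by simp
  have "x \<le> node a b N (Suc j)"
    unfolding j_def by (rule LeastI[of "\<lambda>j. x \<le> node a b N (Suc j)", OF ex])
  moreover have "node a b N j \<le> x"
  proof (cases j)
    case 0
    then show ?thesis using assms by simp
  next
    case (Suc i)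
    then have "\<not> x \<le> node a b N (Suc i)"
      using not_less_Least[of i "\<lambda>j. x \<le> node a b N (Suc j)"] by (simp add: j_def)
    then show ?thesis using Suc by simp
  qed
  moreover have "j \<le> N - 1" unfolding j_def by (rule Least_le[of "\<lambda>j. x \<le> node a b N (Suc j)", OF ex])
  ultimately show ?thesis using that[of j] assms(1) by auto
qed

lemma node_open_cell_unique:
  assumes "a < b" "x \<in> {node a b N i<..<node a b N (Suc i)}"
    "x \<in> {node a b N j<..<node a b N (Suc j)}"
  shows "i = j"
proof (rule ccontr)
  assume "i \<noteq> j"
  then have "Suc i \<le> j \<or> Suc j \<le> i" by auto
  then have "node a b N (Suc i) \<le> node a b N j \<or> node a b N (Suc j) \<le> node a b N i"
    using node_mono[OF assms(1)] by blast
  with assms(2,3) show False by auto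
qed

lemma function_subspace_periodic_lagrange_space:
  "function_subspace (periodic_lagrange_space a b N r)"
proof -
  have "(\<lambda>x. c * f x + d * g x) \<in> lagrange_space a b N r"
    if f: "f \<in> lagrange_space a b N r" and g: "g \<in> lagrange_space a b N r" for c d f g
  proof -
    have "\<exists>p. degree p \<le> r \<and>
        (\<forall>x\<in>{node a b N j..node a b N (Suc j)}. c * f x + d * g x = poly p x)" if j: "j < N" for j
    proof -
      obtain p where p: "degree p \<le> r"
        "\<forall>x\<in>{node a b N j..node a b N (Suc j)}. f x = poly p x"
        using f j unfolding lagrange_space_def by blast
      obtain q where q: "degree q \<le> r"
        "\<forall>x\<in>{node a b N j..node a b N (Suc j)}. g x = poly q x"
        using g j unfolding lagrange_space_def by blast
      from p q show ?thesis
        by (intro exI[of _ "smult c p + smult d q"])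
          (auto intro!: degree_add_le order.trans[OF degree_smult_le])
    qed
    then show ?thesis
      using f g by (auto simp: lagrange_space_def intro!: continuous_intros)
  qed
  moreover have "(\<lambda>x. 0) \<in> lagrange_space a b N r"
    by (auto simp: lagrange_space_def intro!: exI[of _ 0])
  ultimately show ?thesis
    by (auto simp: function_subspace_def periodic_lagrange_space_def)
qed

text \<open>A polynomial of degree at most \<open>r\<close> with \<open>r + 1\<close> zeros is zero,
  so any \<open>r + 1\<close> points in each cell will do. The resulting set supplies the evaluation
  points for the induction in \<open>exists_parseval_frame\<close>.\<close>

lemma lagrange_space_unisolvent:
  assumes "a < b" "N \<ge> 1"
  obtains X where "finite X"
    "\<And>f. f \<in> lagrange_space a b N r \<Longrightarrow> (\<And>x. x \<in> X \<Longrightarrow> f x = 0) \<Longrightarrow> f = (\<lambda>x. 0)"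
proof -
  have "\<exists>Y. Y \<subseteq> {node a b N j..node a b N (Suc j)} \<and> finite Y \<and> card Y = Suc r" for j
  proof -
    have "infinite {node a b N j..node a b N (Suc j)}"
      using node_strict_mono[OF assms, of j "Suc j"] by (simp add: infinite_Icc_iff)
    then show ?thesis by (meson infinite_arbitrarily_large)
  qed
  then obtain Y where Y: "\<And>j. Y j \<subseteq> {node a b N j..node a b N (Suc j)}" "\<And>j. finite (Y j)"
    "\<And>j. card (Y j) = Suc r" by metis
  show ?thesis
  proof (rule that[of "\<Union>j<N. Y j"])
    show "finite (\<Union>j<N. Y j)" using Y by auto
    fix f assume f: "f \<in> lagrange_space a b N r" and 0: "\<And>x. x \<in> (\<Union>j<N. Y j) \<Longrightarrow> f x = 0"
    show "f = (\<lambda>x. 0)"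
    proof
      fix x
      show "f x = 0"
      proof (cases "x \<in> {a..b}")
        case True
        then obtain j where j: "j < N" "x \<in> {node a b N j..node a b N (Suc j)}"
          using node_cell[OF assms(2)] by blast
        then obtain p where p: "degree p \<le> r"
          "\<And>x. x \<in> {node a b N j..node a b N (Suc j)} \<Longrightarrow> f x = poly p x"
          using f unfolding lagrange_space_def by blast
        have "Y j \<subseteq> {x. poly p x = 0}"
          using 0 j p(2) Y(1)[of j] by fastforce
        then have "p = 0"
          using card_mono[of "{x. poly p x = 0}" "Y j"] poly_roots_finite[of p]
            card_poly_roots_bound[of p] Y(3)[of j] p(1) by fastforce
        with p(2) j show ?thesis by simp
      next
        case False
        with f show ?thesis by (simp add: lagrange_space_def)
      qed
    qed
  qed
qed

section \<open>Weak derivative and projection on the periodic space\<close>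

locale periodic_finite_elements =
  fixes a b :: real and N r :: nat
  assumes ab: "a < b" and N: "N \<ge> 1"
begin

abbreviation V where "V \<equiv> periodic_lagrange_space a b N r"
abbreviation inner where "inner \<equiv> L2_inner a b"
abbreviation D where "D \<equiv> deriv_x a b N"
abbreviation proj where "proj \<equiv> L2_proj a b N r"
abbreviation bm where "bm \<equiv> bounded_measurable_on a b"

lemma V_continuous: "f \<in> V \<Longrightarrow> continuous_on {a..b} f"
  by (simp add: periodic_lagrange_space_def lagrange_space_def)

lemma V_outside: "f \<in> V \<Longrightarrow> x \<notin> {a..b} \<Longrightarrow> f x = 0"
  by (simp add: periodic_lagrange_space_def lagrange_space_def)

lemma V_bm: "f \<in> V \<Longrightarrow> bm f"
  by (intro bounded_measurable_on_continuous V_continuous)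

lemma V_cells:
  assumes "f \<in> V"
  obtains p where "\<And>j x. j < N \<Longrightarrow> x \<in> {node a b N j..node a b N (Suc j)} \<Longrightarrow> f x = poly (p j) x"
proof -
  have "\<forall>j\<in>{..<N}. \<exists>p. \<forall>x\<in>{node a b N j..node a b N (Suc j)}. f x = poly p x"
    using assms unfolding periodic_lagrange_space_def lagrange_space_def by blast
  from bchoice[OF this] show ?thesis using that by blast
qed

lemma V_has_derivative:
  assumes f: "f \<in> V" and j: "j < N" and x: "x \<in> {node a b N j<..<node a b N (Suc j)}"
    and p: "\<And>x. x \<in> {node a b N j..node a b N (Suc j)} \<Longrightarrow> f x = poly p x"
  shows "(f has_real_derivative poly (pderiv p) x) (at x)" "D f x = poly (pderiv p) x"
proof -
  show *: "(f has_real_derivative poly (pderiv p) x) (at x)"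
    using x p
    by (intro has_field_derivative_transform_within_open[OF poly_DERIV,
          of "{node a b N j<..<node a b N (Suc j)}"]) auto
  show "D f x = poly (pderiv p) x"
    using x j DERIV_imp_deriv[OF *] by (auto simp: deriv_x_def)
qed

text \<open>The weak derivative is a finite sum of polynomials cut off to open cells. These cells
  are disjoint, so at most one summand is nonzero; at the nodes the sum is 0, in agreement with the
  default value in \<open>deriv_x\<close>.\<close>

lemma D_bm:
  assumes "f \<in> V"
  shows "bm (D f)"
proof -
  obtain p where p: "\<And>j x. j < N \<Longrightarrow> x \<in> {node a b N j..node a b N (Suc j)} \<Longrightarrow> f x = poly (p j) x"
    using V_cells[OF assms] by blast
  define C where "C j = {node a b N j<..<node a b N (Suc j)}" for j
  have "D f x = (\<Sum>j<N. indicator (C j) x * poly (pderiv (p j)) x)" for x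
  proof (cases "\<exists>i<N. x \<in> C i")
    case True
    then obtain i where i: "i < N" "x \<in> C i" by blast
    have "(\<Sum>j<N. indicator (C j) x * poly (pderiv (p j)) x)
        = (\<Sum>j<N. if j = i then poly (pderiv (p i)) x else 0)"
    proof (intro sum.cong refl)
      fix j
      have "x \<in> C j \<longleftrightarrow> j = i"
        using i node_open_cell_unique[OF ab, of x N i j] unfolding C_def by blast
      then show "indicator (C j) x * poly (pderiv (p j)) x
          = (if j = i then poly (pderiv (p i)) x else 0)"
        by (simp add: indicator_def)
    qed
    also have "\<dots> = D f x"
      using V_has_derivative(2)[OF assms i(1) i(2)[unfolded C_def] p[OF i(1)]] i(1) by simp
    finally show ?thesis by simp
  next
    case False
    then have "D f x = 0" by (auto simp: deriv_x_def C_def)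
    with False show ?thesis by (auto simp: indicator_def intro!: sum.neutral[symmetric])
  qed
  moreover have "bm (indicator (C j))" for j
    unfolding bounded_measurable_on_def
  proof
    show "indicator (C j) \<in> borel_measurable (lebesgue_on {a..b})"
      by (intro measurable_restrict_space1 borel_measurable_indicator) (simp add: C_def)
    show "bounded ((indicator (C j) :: real \<Rightarrow> real) ` {a..b})"
      by (rule boundedI[of _ 1]) (auto simp: indicator_def)
  qed
  then have "bm (\<lambda>x. \<Sum>j<N. indicator (C j) x * poly (pderiv (p j)) x)"
    by (intro bounded_measurable_on_sum bounded_measurable_on_mult)
      (auto intro!: bounded_measurable_on_continuous continuous_intros)
  ultimately show ?thesis by presburger
qed

text \<open>Integration by parts: the product \<open>f * g\<close> is continuous across the nodes,
  so these form a finite exceptional set that contributes no jump terms, and the boundary terms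
  cancel by periodicity.\<close>

lemma inner_D_skew:
  assumes f: "f \<in> V" and g: "g \<in> V"
  shows "inner (D f) g = - inner f (D g)"
proof -
  have "((\<lambda>x. D f x * g x + f x * D g x) has_integral f b * g b - f a * g a) {a..b}"
  proof (rule fundamental_theorem_of_calculus_interior_strong[where S="node a b N ` {..N}"])
    show "((\<lambda>x. f x * g x) has_vector_derivative D f x * g x + f x * D g x) (at x)"
      if x: "x \<in> {a<..<b} - node a b N ` {..N}" for x
    proof -
      obtain j where j: "j < N" "x \<in> {node a b N j..node a b N (Suc j)}"
        using node_cell[OF N, of x a b] x by auto
      then have "x \<noteq> node a b N j" "x \<noteq> node a b N (Suc j)" using x by auto
      with j have xj: "x \<in> {node a b N j<..<node a b N (Suc j)}" by simp
      obtain p where p: "\<And>j x. j < N \<Longrightarrow> x \<in> {node a b N j..node a b N (Suc j)} \<Longrightarrow> f x = poly (p j) x"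
        using V_cells[OF f] by blast
      obtain q where q: "\<And>j x. j < N \<Longrightarrow> x \<in> {node a b N j..node a b N (Suc j)} \<Longrightarrow> g x = poly (q j) x"
        using V_cells[OF g] by blast
      from V_has_derivative[OF f j(1) xj p[OF j(1)]] V_has_derivative[OF g j(1) xj q[OF j(1)]]
      have "(f has_real_derivative D f x) (at x)" "(g has_real_derivative D g x) (at x)"
        by simp_all
      from DERIV_mult'[OF this] show ?thesis
        by (simp add: has_real_derivative_iff_has_vector_derivative add.commute)
    qed
  next
    show "continuous_on {a..b} (\<lambda>x. f x * g x)"
      by (intro continuous_intros V_continuous f g)
  qed (use ab in auto)
  moreover have "f a = f b" "g a = g b" using f g by (auto simp: periodic_lagrange_space_def)
  ultimately have "((\<lambda>x. D f x * g x + f x * D g x) has_integral 0) {a..b}" by simp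
  \<comment> \<open>The fundamental theorem gives a gauge integral; integrability of both summands
    identifies it with the Lebesgue integral in \<open>L2_inner\<close>.\<close>
  moreover have int: "integrable (lebesgue_on {a..b}) (\<lambda>x. D f x * g x)"
    "integrable (lebesgue_on {a..b}) (\<lambda>x. f x * D g x)"
    by (intro bounded_measurable_on_integrable bounded_measurable_on_mult D_bm V_bm f g)+
  then have "((\<lambda>x. D f x * g x + f x * D g x) has_integral
      (LINT x|lebesgue_on {a..b}. D f x * g x + f x * D g x)) {a..b}"
    by (intro has_integral_integral_lebesgue_on Bochner_Integration.integrable_add) auto
  ultimately have "(LINT x|lebesgue_on {a..b}. D f x * g x + f x * D g x) = 0"
    by (rule has_integral_unique[symmetric])
  then show ?thesis using int by (simp add: L2_inner_def)
qed

lemma parseval_frame: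
  obtains E where "finite E" "E \<subseteq> V" "\<And>f. f \<in> V \<Longrightarrow> f = (\<lambda>x. \<Sum>e\<in>E. inner f e * e x)"
proof -
  obtain X where "finite X"
    "\<And>f. f \<in> lagrange_space a b N r \<Longrightarrow> (\<And>x. x \<in> X \<Longrightarrow> f x = 0) \<Longrightarrow> f = (\<lambda>x. 0)"
    using lagrange_space_unisolvent[OF ab N, where ?r = r] by blast
  then have "\<exists>E. finite E \<and> E \<subseteq> V \<and> (\<forall>f\<in>V. f = (\<lambda>x. \<Sum>e\<in>E. inner f e * e x))"
    by (intro exists_parseval_frame[OF ab, of X] function_subspace_periodic_lagrange_space
        V_continuous V_outside) (auto simp: periodic_lagrange_space_def)
  then show ?thesis using that by blast
qed

text \<open>As \<open>L2_proj\<close> is a definite description, both existence and uniqueness are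
  needed. The frame sum has the required inner products by symmetry of the double expansion, and any
  competitor in \<open>V\<close> has the same frame coefficients, hence the same expansion.\<close>

lemma proj_frame:
  assumes E: "finite E" "E \<subseteq> V" and rep: "\<And>f. f \<in> V \<Longrightarrow> f = (\<lambda>x. \<Sum>e\<in>E. inner f e * e x)"
    and f: "bm f"
  shows "proj f = (\<lambda>x. \<Sum>e\<in>E. inner f e * e x)"
    and "proj f \<in> V" and "\<phi> \<in> V \<Longrightarrow> inner (proj f) \<phi> = inner f \<phi>"
proof -
  let ?p = "\<lambda>x. \<Sum>e\<in>E. inner f e * e x"
  have EV: "e \<in> V" if "e \<in> E" for e using that E by auto
  have p: "?p \<in> V"
    by (intro function_subspace_sum function_subspace_periodic_lagrange_space EV)
  have inner_sum: "inner (\<lambda>x. \<Sum>e\<in>E. c e * e x) h = (\<Sum>e\<in>E. c e * inner e h)" if "bm h" for c h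
    by (subst L2_inner_sum_left)
      (auto simp: L2_inner_cmult_left intro!: that EV V_bm bounded_measurable_on_cmult)
  have inner_p: "inner ?p \<phi> = inner f \<phi>" if \<phi>: "\<phi> \<in> V" for \<phi>
  proof -
    have "inner \<phi> f = (\<Sum>e\<in>E. inner \<phi> e * inner e f)"
      using inner_sum[OF f, of "inner \<phi>"] rep[OF \<phi>] by simp
    also have "\<dots> = (\<Sum>e\<in>E. inner f e * inner e \<phi>)"
      by (intro sum.cong refl) (metis L2_inner_commute mult.commute)
    also have "\<dots> = inner ?p \<phi>" using inner_sum[OF V_bm[OF \<phi>], of "inner f"] by simp
    finally show ?thesis by (metis L2_inner_commute)
  qed
  have "q = ?p" if q: "q \<in> V" "\<And>\<phi>. \<phi> \<in> V \<Longrightarrow> inner q \<phi> = inner f \<phi>" for q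
  proof -
    have "(\<lambda>x. \<Sum>e\<in>E. inner q e * e x) = ?p"
      by (intro ext sum.cong refl) (simp only: q(2) EV)
    then show ?thesis by (rule trans[OF rep[OF q(1)]])
  qed
  then show eq: "proj f = ?p"
    unfolding L2_proj_def using p inner_p by (intro the_equality) blast+
  show "proj f \<in> V"
    unfolding eq by (rule p)
  show "inner (proj f) \<phi> = inner f \<phi>" if "\<phi> \<in> V"
    unfolding eq by (rule inner_p[OF that])
qed

lemma proj_V: "bm f \<Longrightarrow> proj f \<in> V"
  and inner_proj: "bm f \<Longrightarrow> \<phi> \<in> V \<Longrightarrow> inner (proj f) \<phi> = inner f \<phi>"
proof -
  obtain E where "finite E" "E \<subseteq> V" "\<And>f. f \<in> V \<Longrightarrow> f = (\<lambda>x. \<Sum>e\<in>E. inner f e * e x)"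
    using parseval_frame by blast
  note * = proj_frame(2,3)[OF this]
  show "bm f \<Longrightarrow> proj f \<in> V" "bm f \<Longrightarrow> \<phi> \<in> V \<Longrightarrow> inner (proj f) \<phi> = inner f \<phi>"
    by (rule *; assumption)+
qed

lemma indicator_eq_1_on_cell:
  "j < N \<Longrightarrow> x \<in> {node a b N j..node a b N (Suc j)} \<Longrightarrow> indicator {a..b} x = poly 1 x"
  using node_in_interval[OF ab N, of j] node_in_interval[OF ab N, of "Suc j"] by simp

text \<open>In the encoding by zero extension the constant test function 1 is this
  indicator.\<close>

lemma indicator_V: "indicator {a..b} \<in> V"
proof -
  have "continuous_on {a..b} (indicator {a..b} :: real \<Rightarrow> real)"
    by (rule continuous_on_eq[OF continuous_on_const[of _ 1]]) simp
  moreover have "\<forall>j<N. \<exists>p. degree p \<le> r \<and>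
      (\<forall>x\<in>{node a b N j..node a b N (Suc j)}. indicator {a..b} x = poly p x)"
    using indicator_eq_1_on_cell by (intro allI impI exI[of _ 1]) auto
  ultimately show ?thesis
    using ab by (simp add: periodic_lagrange_space_def lagrange_space_def)
qed

lemma D_indicator: "D (indicator {a..b}) = (\<lambda>x. 0)"
proof
  fix x
  show "D (indicator {a..b}) x = 0"
  proof (cases "\<exists>j<N. node a b N j < x \<and> x < node a b N (Suc j)")
    case True
    then obtain j where "j < N" "x \<in> {node a b N j<..<node a b N (Suc j)}" by auto
    from V_has_derivative(2)[OF indicator_V this indicator_eq_1_on_cell[OF this(1)]]
    show ?thesis by (simp add: pderiv_1)
  next
    case False
    then show ?thesis unfolding deriv_x_def by (rule if_not_P)
  qed
qed

lemma inner_indicator: "inner f (indicator {a..b}) = inner f (\<lambda>x. 1)"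
  unfolding L2_inner_def by (intro Bochner_Integration.integral_cong) auto

end

section \<open>Continuously differentiable curves in the periodic space\<close>

locale periodic_finite_element_curves = periodic_finite_elements +
  fixes T :: real
  assumes T: "T > 0"
begin

text \<open>Since \<open>T > 0\<close>, derivatives within \<open>{0..T}\<close> are unique also at
  the end points, and agreement at times in that interval suffices.\<close>

lemma deriv_t_eqI:
  assumes "t \<in> {0..T}" "(f has_real_derivative d) (at t within {0..T})"
    and "\<And>s. s \<in> {0..T} \<Longrightarrow> w s x = f s"
  shows "deriv_t T w t x = d"
proof -
  have "((\<lambda>s. w s x) has_vector_derivative d) (at t within {0..T})"
    by (rule has_vector_derivative_transform[OF assms(1,3)
          assms(2)[unfolded has_real_derivative_iff_has_vector_derivative]])
  then show ?thesis
    unfolding deriv_t_def using T assms(1)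
    by (intro vector_derivative_within_closed_interval) auto
qed

lemma curve_in_V: "C1_curve a b T V w \<Longrightarrow> s \<in> {0..T} \<Longrightarrow> w s \<in> V"
  by (simp add: C1_curve_def)

lemma curve_has_uniform_derivative:
  assumes w: "C1_curve a b T V w" and t: "t \<in> {0..T}"
  shows "has_uniform_derivative_on w (deriv_t T w t) {a..b} t {0..T}"
  using w t by (simp add: C1_curve_def has_uniform_derivative_on_def)

text \<open>The time derivative is a uniform limit of continuous difference quotients, along a
  filter that is nontrivial because \<open>T > 0\<close>.\<close>

lemma deriv_t_bm:
  assumes w: "C1_curve a b T V w" and t: "t \<in> {0..T}"
  shows "bm (deriv_t T w t)"
proof (rule bounded_measurable_on_continuous, rule uniform_limit_theorem)
  show "uniform_limit {a..b} (\<lambda>s x. (w s x - w t x) / (s - t)) (deriv_t T w t) (at t within {0..T})"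
    using curve_has_uniform_derivative[OF w t] by (simp add: has_uniform_derivative_on_def)
  show "\<forall>\<^sub>F s in at t within {0..T}. continuous_on {a..b} (\<lambda>x. (w s x - w t x) / (s - t))"
    unfolding eventually_at_filter divide_inverse
    by (intro always_eventually allI impI continuous_intros V_continuous curve_in_V w t)
  show "\<not> trivial_limit (at t within {0..T})"
    using T t by (simp add: trivial_limit_within)
qed

lemma has_real_derivative_inner_curve:
  assumes w: "C1_curve a b T V w" and t: "t \<in> {0..T}" and g: "bm g"
  shows "((\<lambda>s. inner (w s) g) has_real_derivative inner (deriv_t T w t) g) (at t within {0..T})"
  by (rule has_real_derivative_L2_inner[OF curve_has_uniform_derivative[OF w t] t
        V_bm[OF curve_in_V[OF w]] deriv_t_bm[OF w t] g])

text \<open>The frame elements are fixed and the coefficients of \<open>w s\<close> are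
  differentiable scalars, so the derivative is again a combination of frame elements. The argument
  covers every real \<open>x\<close>, including points outside \<open>{a..b}\<close>, where the
  uniform limits give no information.\<close>

lemma deriv_t_V:
  assumes w: "C1_curve a b T V w" and t: "t \<in> {0..T}"
  shows "deriv_t T w t \<in> V"
proof -
  obtain E where E: "finite E" "E \<subseteq> V" and rep: "\<And>f. f \<in> V \<Longrightarrow> f = (\<lambda>x. \<Sum>e\<in>E. inner f e * e x)"
    using parseval_frame by blast
  have "deriv_t T w t x = (\<Sum>e\<in>E. inner (deriv_t T w t) e * e x)" for x
  proof (rule deriv_t_eqI[OF t])
    show "((\<lambda>s. \<Sum>e\<in>E. inner (w s) e * e x) has_real_derivative
        (\<Sum>e\<in>E. inner (deriv_t T w t) e * e x)) (at t within {0..T})"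
      using E by (intro DERIV_sum DERIV_cmult_right has_real_derivative_inner_curve w t V_bm) auto
    show "w s x = (\<Sum>e\<in>E. inner (w s) e * e x)" if "s \<in> {0..T}" for s
      by (rule fun_cong[OF rep[OF curve_in_V[OF w that]]])
  qed
  then have "deriv_t T w t = (\<lambda>x. \<Sum>e\<in>E. inner (deriv_t T w t) e * e x)" by blast
  moreover have "\<dots> \<in> V"
    using E by (intro function_subspace_sum function_subspace_periodic_lagrange_space) auto
  ultimately show ?thesis by metis
qed

text \<open>As \<open>D\<close> is skew, the frame coefficients of \<open>proj (D (w s))\<close> are inner products of \<open>w s\<close> with
  fixed functions, so \<open>w\<close> can be differentiated without differentiating \<open>D (w s)\<close> in time.\<close>

lemma deriv_t_proj_D:
  assumes w: "C1_curve a b T V w" and t: "t \<in> {0..T}"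
  shows "deriv_t T (\<lambda>s. proj (D (w s))) t = proj (D (deriv_t T w t))"
proof
  fix x
  obtain E where E: "finite E" "E \<subseteq> V" and rep: "\<And>f. f \<in> V \<Longrightarrow> f = (\<lambda>x. \<Sum>e\<in>E. inner f e * e x)"
    using parseval_frame by blast
  have proj: "proj (D f) x = (\<Sum>e\<in>E. - inner f (D e) * e x)" if "f \<in> V" for f
  proof -
    have "proj (D f) x = (\<Sum>e\<in>E. inner (D f) e * e x)"
      by (rule fun_cong[OF proj_frame(1)[OF E rep D_bm[OF that]]])
    also have "\<dots> = (\<Sum>e\<in>E. - inner f (D e) * e x)"
      using E(2) inner_D_skew[OF that] by (intro sum.cong refl) auto
    finally show ?thesis .
  qed
  show "deriv_t T (\<lambda>s. proj (D (w s))) t x = proj (D (deriv_t T w t)) x"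
    unfolding proj[OF deriv_t_V[OF w t]]
  proof (rule deriv_t_eqI[OF t])
    show "((\<lambda>s. \<Sum>e\<in>E. - inner (w s) (D e) * e x) has_real_derivative
        (\<Sum>e\<in>E. - inner (deriv_t T w t) (D e) * e x)) (at t within {0..T})"
      using E by (intro DERIV_sum DERIV_cmult_right DERIV_minus has_real_derivative_inner_curve w t D_bm)
        auto
    show "proj (D (w s)) x = (\<Sum>e\<in>E. - inner (w s) (D e) * e x)" if "s \<in> {0..T}" for s
      by (rule proj[OF curve_in_V[OF w that]])
  qed
qed

text \<open>The functions paired with the time derivatives are the variational derivatives of the
  energy with respect to \<open>\<eta>\<close> and \<open>u\<close>. The integrand is differentiated
  by the product rule and integrated by pairing with 1.\<close>

lemma energy_has_real_derivative:
  assumes \<eta>: "C1_curve a b T V \<eta>" and u: "C1_curve a b T V u" and t: "t \<in> {0..T}"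
  shows "((\<lambda>s. energy a b s \<eta> u) has_real_derivative
      inner (\<lambda>x. \<eta> t x + 1 / 2 * (u t x)\<^sup>2) (deriv_t T \<eta> t)
      + inner (\<lambda>x. (1 + \<eta> t x) * u t x) (deriv_t T u t)) (at t within {0..T})"
proof -
  let ?\<eta>t = "deriv_t T \<eta> t" and ?ut = "deriv_t T u t"
  let ?A = "\<lambda>x. \<eta> t x + 1 / 2 * (u t x)\<^sup>2" and ?B = "\<lambda>x. (1 + \<eta> t x) * u t x"
  let ?f = "\<lambda>s x. \<eta> s x * \<eta> s x + (1 + \<eta> s x) * (u s x * u s x)"
  \<comment> \<open>The unsimplified form, with its summand 0, is the one produced by the sum and
    product rules.\<close>
  let ?f' = "\<lambda>x. (?\<eta>t x * \<eta> t x + \<eta> t x * ?\<eta>t x) +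
     ((0 + ?\<eta>t x) * (u t x * u t x) + (1 + \<eta> t x) * (?ut x * u t x + u t x * ?ut x))"
  note bm = V_bm[OF curve_in_V[OF \<eta>]] V_bm[OF curve_in_V[OF u]]
    deriv_t_bm[OF \<eta> t] deriv_t_bm[OF u t]
  note bm_intros = bounded_measurable_on_add bounded_measurable_on_mult bounded_measurable_on_const
  have bounded: "bounded (f ` {a..b})" if "bm f" for f
    using that by (simp add: bounded_measurable_on_def)
  have "has_uniform_derivative_on ?f ?f' {a..b} t {0..T}"
    by (intro has_uniform_derivative_on_add has_uniform_derivative_on_mult
        has_uniform_derivative_on_const curve_has_uniform_derivative \<eta> u t bounded bm_intros bm)
  then have "((\<lambda>s. inner (?f s) (\<lambda>x. 1)) has_real_derivative inner ?f' (\<lambda>x. 1)) (at t within {0..T})"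
    by (rule has_real_derivative_L2_inner[OF _ t]) (intro bm_intros bm t; assumption)+
  then have "((\<lambda>s. 1 / 2 * inner (?f s) (\<lambda>x. 1)) has_real_derivative 1 / 2 * inner ?f' (\<lambda>x. 1))
      (at t within {0..T})"
    by (rule DERIV_cmult)
  moreover have "(\<lambda>s. 1 / 2 * inner (?f s) (\<lambda>x. 1)) = (\<lambda>s. energy a b s \<eta> u)"
    by (simp add: energy_def L2_inner_def power2_eq_square)
  moreover have "1 / 2 * inner ?f' (\<lambda>x. 1) = inner ?A ?\<eta>t + inner ?B ?ut"
  proof -
    have "?f' = (\<lambda>x. 2 * (?A x * ?\<eta>t x) + 2 * (?B x * ?ut x))"
      by (simp add: fun_eq_iff power2_eq_square algebra_simps)
    moreover have "bm (\<lambda>x. ?A x * ?\<eta>t x)" "bm (\<lambda>x. ?B x * ?ut x)"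
      unfolding power2_eq_square by (intro bm_intros bm t)+
    ultimately have "inner ?f' (\<lambda>x. 1) =
        2 * inner (\<lambda>x. ?A x * ?\<eta>t x) (\<lambda>x. 1) + 2 * inner (\<lambda>x. ?B x * ?ut x) (\<lambda>x. 1)"
      by (simp only: L2_inner_linear_left bounded_measurable_on_const)
    then show ?thesis by (simp add: L2_inner_def)
  qed
  ultimately show ?thesis by (simp only:)
qed

section \<open>The three conservation laws\<close>

lemma conservation_laws:
  assumes \<eta>: "C1_curve a b T V \<eta>" and u: "C1_curve a b T V u" and t: "t \<in> {0..T}"
    and eq_\<eta>: "\<And>\<phi>. \<phi> \<in> V \<Longrightarrow>
      inner (deriv_t T \<eta> t) \<phi> + 1 / 6 * inner (deriv_t T (\<lambda>s. proj (D (\<eta> s))) t) (D \<phi>)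
      = inner (proj (\<lambda>x. (1 + \<eta> t x) * u t x)) (D \<phi>)"
    and eq_u: "\<And>\<psi>. \<psi> \<in> V \<Longrightarrow>
      inner (deriv_t T u t) \<psi> + 1 / 6 * inner (deriv_t T (\<lambda>s. proj (D (u s))) t) (D \<psi>)
      = 1 / 2 * inner (proj (\<lambda>x. (u t x)\<^sup>2)) (D \<psi>) + inner (proj (\<eta> t)) (D \<psi>)"
  shows "((\<lambda>s. mass a b s \<eta>) has_real_derivative 0) (at t within {0..T}) \<and>
    ((\<lambda>s. momentum a b s u) has_real_derivative 0) (at t within {0..T}) \<and>
    ((\<lambda>s. energy a b s \<eta> u) has_real_derivative 0) (at t within {0..T})"
proof -
  define \<eta>t where "\<eta>t = deriv_t T \<eta> t"
  define ut where "ut = deriv_t T u t"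
  define F where "F = proj (\<lambda>x. (1 + \<eta> t x) * u t x)"
  define G where "G = (\<lambda>x. 1 / 2 * proj (\<lambda>x. (u t x)\<^sup>2) x + 1 * proj (\<eta> t) x)"
  \<comment> \<open>The two equations of the scheme say that \<open>\<eta>t\<close> and \<open>ut\<close> are minus the discrete derivatives
    of the fluxes \<open>K\<close> and \<open>H\<close>, into which the dispersive terms are absorbed.\<close>
  define K where "K = (\<lambda>x. 1 * F x + (- 1 / 6) * proj (D \<eta>t) x)"
  define H where "H = (\<lambda>x. 1 * G x + (- 1 / 6) * proj (D ut) x)"
  note sub = function_subspaceD[OF function_subspace_periodic_lagrange_space]
  have \<eta>t: "\<eta>t \<in> V" and ut: "ut \<in> V"
    unfolding \<eta>t_def ut_def by (rule deriv_t_V[OF \<eta> t] deriv_t_V[OF u t])+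
  have bm: "bm (\<eta> t)" "bm (\<lambda>x. (u t x)\<^sup>2)" "bm (\<lambda>x. (1 + \<eta> t x) * u t x)"
    unfolding power2_eq_square
    by (intro bounded_measurable_on_add bounded_measurable_on_mult bounded_measurable_on_const
        V_bm curve_in_V[OF \<eta> t] curve_in_V[OF u t])+
  have V: "F \<in> V" "G \<in> V" "proj (D \<eta>t) \<in> V" "proj (D ut) \<in> V"
    unfolding F_def G_def by (intro sub proj_V bm D_bm \<eta>t ut)+
  \<comment> \<open>Membership in \<open>V\<close> makes each flux an admissible test function in
    the equation of the other.\<close>
  have KH: "K \<in> V" "H \<in> V" unfolding K_def H_def by (intro V sub)+
  have inner_K: "inner K f = inner F f - 1 / 6 * inner (proj (D \<eta>t)) f"
    and inner_H: "inner H f = inner G f - 1 / 6 * inner (proj (D ut)) f" if "bm f" for f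
    unfolding K_def H_def
    by (subst L2_inner_linear_left; simp add: V_bm V that)+
  have inner_G: "inner G f = 1 / 2 * inner (proj (\<lambda>x. (u t x)\<^sup>2)) f + inner (proj (\<eta> t)) f"
    if "bm f" for f
    unfolding G_def by (subst L2_inner_linear_left) (auto intro: V_bm proj_V bm that)
  \<comment> \<open>By \<open>deriv_t_proj_D\<close> the dispersive term involves only the projected
    weak derivative of \<open>\<eta>t\<close>, which is the part absorbed into
    \<open>K\<close>.\<close>
  have eq1: "inner \<eta>t \<phi> = inner K (D \<phi>)" if "\<phi> \<in> V" for \<phi>
    using eq_\<eta>[OF that] inner_K[OF D_bm[OF that]]
    by (simp add: deriv_t_proj_D[OF \<eta> t] \<eta>t_def F_def)
  have eq2: "inner ut \<phi> = inner H (D \<phi>)" if "\<phi> \<in> V" for \<phi>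
    using eq_u[OF that] inner_H[OF D_bm[OF that]] inner_G[OF D_bm[OF that]]
    by (simp add: deriv_t_proj_D[OF u t] ut_def)

  \<comment> \<open>Testing with the zero-extended constant removes the fluxes, as its weak
    derivative is 0.\<close>
  have "inner \<eta>t (\<lambda>x. 1) = 0" "inner ut (\<lambda>x. 1) = 0"
    using eq1[OF indicator_V] eq2[OF indicator_V]
    by (simp_all only: D_indicator inner_indicator) (simp_all add: L2_inner_def)
  moreover have "mass a b s w = inner (w s) (\<lambda>x. 1)" "momentum a b s w = inner (w s) (\<lambda>x. 1)" for s w
    by (simp_all add: mass_def momentum_def L2_inner_def)
  ultimately have "((\<lambda>s. mass a b s \<eta>) has_real_derivative 0) (at t within {0..T})"
    "((\<lambda>s. momentum a b s u) has_real_derivative 0) (at t within {0..T})"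
    using has_real_derivative_inner_curve[OF \<eta> t bounded_measurable_on_const[of a b 1]]
      has_real_derivative_inner_curve[OF u t bounded_measurable_on_const[of a b 1]]
    by (simp_all add: \<eta>t_def ut_def)

  moreover have "((\<lambda>s. energy a b s \<eta> u) has_real_derivative 0) (at t within {0..T})"
  proof -
    \<comment> \<open>Against \<open>\<eta>t\<close>, an element of \<open>V\<close>, the
      variational derivative may be replaced by its projection \<open>G\<close>. Writing
      \<open>G\<close> as \<open>H\<close> plus the dispersive term then allows the first equation
      to be tested with \<open>H\<close>.\<close>
    have "inner (\<lambda>x. \<eta> t x + 1 / 2 * (u t x)\<^sup>2) \<eta>t = inner (\<eta> t) \<eta>t + 1 / 2 * inner (\<lambda>x. (u t x)\<^sup>2) \<eta>t"
      using L2_inner_linear_left[OF bm(1,2) V_bm[OF \<eta>t], of 1 "1 / 2"] by simp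
    also have "\<dots> = inner G \<eta>t"
      using inner_G[OF V_bm[OF \<eta>t]] by (simp add: inner_proj bm \<eta>t)
    also have "\<dots> = inner \<eta>t H + 1 / 6 * inner (D ut) \<eta>t"
      using inner_H[OF V_bm[OF \<eta>t]] inner_proj[OF D_bm[OF ut] \<eta>t] by (simp add: L2_inner_commute)
    finally have 1: "inner (\<lambda>x. \<eta> t x + 1 / 2 * (u t x)\<^sup>2) \<eta>t
      = inner K (D H) + 1 / 6 * inner (D ut) \<eta>t" by (simp only: eq1 KH)
    have "inner (\<lambda>x. (1 + \<eta> t x) * u t x) ut = inner F ut"
      unfolding F_def by (simp add: inner_proj bm ut)
    also have "\<dots> = inner ut K + 1 / 6 * inner (D \<eta>t) ut"
      using inner_K[OF V_bm[OF ut]] inner_proj[OF D_bm[OF \<eta>t] ut] by (simp add: L2_inner_commute)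
    finally have 2: "inner (\<lambda>x. (1 + \<eta> t x) * u t x) ut = inner H (D K) + 1 / 6 * inner (D \<eta>t) ut"
      by (simp only: eq2 KH)
    have "inner K (D H) + inner H (D K) = 0" "inner (D ut) \<eta>t + inner (D \<eta>t) ut = 0"
      using inner_D_skew[OF KH(2,1)] inner_D_skew[OF ut \<eta>t] by (simp_all add: L2_inner_commute)
    with 1 2 have "inner (\<lambda>x. \<eta> t x + 1 / 2 * (u t x)\<^sup>2) \<eta>t + inner (\<lambda>x. (1 + \<eta> t x) * u t x) ut = 0"
      by (simp add: algebra_simps)
    then show ?thesis
      using energy_has_real_derivative[OF \<eta> u t] by (simp add: \<eta>t_def ut_def)
  qed
  ultimately show ?thesis
    by blast
qed

end

theorem proposition2p2:
  fixes a b T :: real and N r :: nat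
    and \<eta>0 u0 :: "real \<Rightarrow> real" and \<eta> u :: "real \<Rightarrow> real \<Rightarrow> real"
  assumes "a < b" and "N \<ge> 1" and "r \<ge> 1" and "T > 0"
    and "square_integrable_on a b \<eta>0" and "square_integrable_on a b u0"
    and "C1_curve a b T (periodic_lagrange_space a b N r) \<eta>"
    and "C1_curve a b T (periodic_lagrange_space a b N r) u"
    and "\<And>t \<phi>. t \<in> {0..T} \<Longrightarrow> \<phi> \<in> periodic_lagrange_space a b N r \<Longrightarrow>
      L2_inner a b (deriv_t T \<eta> t) \<phi>
        + 1 / 6 * L2_inner a b (deriv_t T (\<lambda>s. L2_proj a b N r (deriv_x a b N (\<eta> s))) t)
                    (deriv_x a b N \<phi>)
      = L2_inner a b (L2_proj a b N r (\<lambda>x. (1 + \<eta> t x) * u t x)) (deriv_x a b N \<phi>)"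
    and "\<And>t \<psi>. t \<in> {0..T} \<Longrightarrow> \<psi> \<in> periodic_lagrange_space a b N r \<Longrightarrow>
      L2_inner a b (deriv_t T u t) \<psi>
        + 1 / 6 * L2_inner a b (deriv_t T (\<lambda>s. L2_proj a b N r (deriv_x a b N (u s))) t)
                    (deriv_x a b N \<psi>)
      = 1 / 2 * L2_inner a b (L2_proj a b N r (\<lambda>x. (u t x)\<^sup>2)) (deriv_x a b N \<psi>)
        + L2_inner a b (L2_proj a b N r (\<eta> t)) (deriv_x a b N \<psi>)"
    and "\<eta> 0 = L2_proj a b N r \<eta>0" and "u 0 = L2_proj a b N r u0"
  shows "\<forall>t\<in>{0..T}.
    ((\<lambda>s. mass a b s \<eta>) has_real_derivative 0) (at t within {0..T}) \<and>
    ((\<lambda>s. momentum a b s u) has_real_derivative 0) (at t within {0..T}) \<and>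
    ((\<lambda>s. energy a b s \<eta> u) has_real_derivative 0) (at t within {0..T})"
proof -
  have "periodic_finite_element_curves a b N T"
    using assms(1,2,4) by unfold_locales
  from periodic_finite_element_curves.conservation_laws[OF this assms(7,8) _ assms(9,10)]
  show ?thesis by blast
qed

end
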